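(* Let $G=(V,E)$ be an infinite, connected, locally finite, vertex-transitive graph. Let $(s(x))_{x\in V}$ be independent and identically distributed real random variables with $\mathbb{E}\, s(x)=1$ and $0<\operatorname{Var} s(x)<\infty$. Then almost surely the divisible sandpile $s$ does not stabilize.
   Context: Graphs are connected, locally finite and undirected; $x\sim y$ means $x,y$ are adjacent and $\deg(x)$ is the number of neighbours of $x$. The graph Laplacian is $\Delta u(x)=\sum_{y\sim x}(u(y)-u(x))$. A divisible sandpile is a function $s:V\to\mathbb{R}$. Let $\mathcal{F}_s=\{f:V\to\mathbb{R} \,:\, f\ge 0 \text{ and } s+\Delta f\le 1 \text{ pointwise}\}$. The sandpile $s$ is said to stabilize if $\mathcal{F}_s\neq\emptyset$ (equivalently, there is a finite toppling procedure after which every site has mass $\le 1$, where a site with mass $>1$ topples by keeping mass $1$ and distributing the excess equally among its neighbours). *)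

theory Defs
  imports "HOL-Probability.Probability"
begin

text \<open>A graph on vertex type 'v is given by an adjacency relation adj (x \<sim> y).
  The vertex set is the whole type 'v.\<close>

definition undirected_graph :: "('v \<Rightarrow> 'v \<Rightarrow> bool) \<Rightarrow> bool" where
  "undirected_graph adj \<longleftrightarrow> (\<forall>x y. adj x y \<longleftrightarrow> adj y x) \<and> (\<forall>x. \<not> adj x x)"

definition locally_finite :: "('v \<Rightarrow> 'v \<Rightarrow> bool) \<Rightarrow> bool" where
  "locally_finite adj \<longleftrightarrow> (\<forall>x. finite {y. adj x y})"

definition graph_connected :: "('v \<Rightarrow> 'v \<Rightarrow> bool) \<Rightarrow> bool" where
  "graph_connected adj \<longleftrightarrow> (\<forall>x y. adj\<^sup>*\<^sup>* x y)"

definition graph_automorphism :: "('v \<Rightarrow> 'v \<Rightarrow> bool) \<Rightarrow> ('v \<Rightarrow> 'v) \<Rightarrow> bool" where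
  "graph_automorphism adj \<phi> \<longleftrightarrow> bij \<phi> \<and> (\<forall>x y. adj x y \<longleftrightarrow> adj (\<phi> x) (\<phi> y))"

definition vertex_transitive :: "('v \<Rightarrow> 'v \<Rightarrow> bool) \<Rightarrow> bool" where
  "vertex_transitive adj \<longleftrightarrow> (\<forall>x y. \<exists>\<phi>. graph_automorphism adj \<phi> \<and> \<phi> x = y)"

definition laplacian :: "('v \<Rightarrow> 'v \<Rightarrow> bool) \<Rightarrow> ('v \<Rightarrow> real) \<Rightarrow> 'v \<Rightarrow> real" where
  "laplacian adj u x = (\<Sum>y\<in>{y. adj x y}. u y - u x)"

definition stabilizing_odometers :: "('v \<Rightarrow> 'v \<Rightarrow> bool) \<Rightarrow> ('v \<Rightarrow> real) \<Rightarrow> ('v \<Rightarrow> real) set" where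
  "stabilizing_odometers adj s =
     {f. (\<forall>x. f x \<ge> 0) \<and> (\<forall>x. s x + laplacian adj f x \<le> 1)}"

definition stabilizes :: "('v \<Rightarrow> 'v \<Rightarrow> bool) \<Rightarrow> ('v \<Rightarrow> real) \<Rightarrow> bool" where
  "stabilizes adj s \<longleftrightarrow> stabilizing_odometers adj s \<noteq> {}"

end

theory Submission
  imports Defs
begin

text \<open>
  Let \<open>P\<close> be averaging over neighbours, \<open>d\<close> the degree, \<open>\<xi> = (s - 1) / d\<close>, and let \<open>u\<close> be the
  increasing limit of the parallel topplings \<open>u\<^sub>0 = 0\<close>, \<open>u\<^sub>n\<^sub>+\<^sub>1 = max 0 (\<xi> + P u\<^sub>n)\<close>, which is
  dominated by every stabilizing odometer. On the event \<open>A\<close> that \<open>u\<close> is finite: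

  \<^item> Mass is conserved: invariance under automorphisms gives \<open>E[u\<^sub>n\<^sub>+\<^sub>1 - P u\<^sub>n - \<xi>; A] = E[u\<^sub>n\<^sub>+\<^sub>1 - u\<^sub>n; A]\<close>,
    and the increments are bounded by \<open>P\<^sup>n |\<xi>|\<close>, hence bounded in L2, and tend to 0 on \<open>A\<close>.
    So \<open>u = P u + \<xi>\<close> almost surely on \<open>A\<close>.

  \<^item> For some \<open>a > 0\<close> the event \<open>\<xi> < - a\<close> has positive probability. Lowering \<open>s\<close> on a large ball to
    such values yields another typical configuration, with odometer \<open>u' \<ge> 0\<close>; then \<open>h = u - u' \<ge> 0\<close>
    satisfies \<open>h = P h + b\<close> with \<open>b \<ge> 0\<close> everywhere and \<open>b \<ge> \<xi> + a\<close> on the ball. Hence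
    \<open>u \<ge> \<Sum>\<^sub>m\<^sub>\<le>\<^sub>k\<^sub><\<^sub>m\<^sub>+\<^sub>n P\<^sup>k (\<xi> + a) = a n + \<Sum>\<^sub>m\<^sub>\<le>\<^sub>k\<^sub><\<^sub>m\<^sub>+\<^sub>n P\<^sup>k \<xi>\<close> almost surely on \<open>A\<close>, for all \<open>m\<close> and \<open>n\<close>.

  Since the graph is infinite, the heat kernel decays and \<open>P\<^sup>k \<xi> \<rightarrow> 0\<close> in L2. Letting first \<open>m\<close> and
  then \<open>n\<close> tend to infinity forces \<open>u = \<infinity>\<close> almost surely on \<open>A\<close>, so \<open>A\<close> is a null set.
\<close>

section \<open>Infinite vertex-transitive graphs\<close>

locale transitive_graph =
  fixes adj :: "'v \<Rightarrow> 'v \<Rightarrow> bool"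
  assumes undirected: "undirected_graph adj"
    and infinite_vertices: "infinite (UNIV :: 'v set)"
    and connected: "graph_connected adj"
    and finite_degree: "locally_finite adj"
    and transitive: "vertex_transitive adj"
begin

lemma adj_sym: "adj x y \<longleftrightarrow> adj y x"
  using undirected by (auto simp: undirected_graph_def)

lemma finite_neighbours [simp]: "finite {y. adj x y}"
  using finite_degree by (auto simp: locally_finite_def)

lemma obtain_automorphism:
  obtains \<phi> where "graph_automorphism adj \<phi>" "\<phi> x = y"
  using transitive by (auto simp: vertex_transitive_def)

lemma automorphism_neighbours:
  assumes "graph_automorphism adj \<phi>"
  shows "bij_betw \<phi> {y. adj x y} {y. adj (\<phi> x) y}"
proof -
  have \<phi>: "bij \<phi>" "\<And>x y. adj x y \<longleftrightarrow> adj (\<phi> x) (\<phi> y)"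
    using assms by (auto simp: graph_automorphism_def)
  have "\<phi> ` {y. adj x y} = {y. adj (\<phi> x) y}"
  proof safe
    fix z assume "adj (\<phi> x) z"
    moreover obtain y where "z = \<phi> y" using \<phi>(1) by (metis bij_pointE)
    ultimately show "z \<in> \<phi> ` {y. adj x y}" using \<phi>(2) by auto
  qed (use \<phi> in auto)
  then show ?thesis
    using \<phi>(1) by (auto simp: bij_betw_def intro: inj_on_subset)
qed

text \<open>\<open>undefined\<close> stands for an arbitrary vertex; by transitivity the choice does
  not affect the value.\<close>

definition deg :: nat where
  "deg = card {y. adj undefined y}"

lemma card_neighbours: "card {y. adj x y} = deg"
proof -
  obtain \<phi> where "graph_automorphism adj \<phi>" "\<phi> x = undefined"
    by (rule obtain_automorphism)
  then show ?thesis
    using automorphism_neighbours[of \<phi> x] by (auto simp: deg_def dest: bij_betw_same_card)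
qed

lemma deg_pos: "deg > 0"
proof -
  obtain x y :: 'v where "x \<noteq> y"
    using infinite_vertices by (metis finite.simps infinite_imp_nonempty UNIV_eq_I insertCI)
  have "adj\<^sup>*\<^sup>* x y"
    using connected by (auto simp: graph_connected_def)
  then obtain z where "adj x z"
    using \<open>x \<noteq> y\<close> by (metis converse_rtranclpE)
  then have "{y. adj x y} \<noteq> {}" by auto
  then have "card {y. adj x y} > 0" by (simp add: card_gt_0_iff)
  then show ?thesis by (simp add: card_neighbours)
qed

lemma finite_sphere: "finite {y. (adj ^^ k) x y}"
proof (induction k)
  case (Suc k)
  have "{y. (adj ^^ Suc k) x y} = (\<Union>z\<in>{z. (adj ^^ k) x z}. {y. adj z y})"
    by auto
  then show ?case using Suc by simp
qed simp

lemma obtain_walk: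
  obtains k where "(adj ^^ k) x y"
  using connected rtranclp_imp_relpowp[of adj x y] by (auto simp: graph_connected_def)

text \<open>Used to make \<open>topple_bounded\<close> measurable and to collect almost sure
  statements over all vertices.\<close>

lemma countable_vertices: "countable (UNIV :: 'v set)"
proof (rule countable_subset)
  show "(UNIV :: 'v set) \<subseteq> (\<Union>k. {y. (adj ^^ k) undefined y})"
    using obtain_walk[of undefined] by blast
  show "countable (\<Union>k. {y. (adj ^^ k) undefined y})"
    by (rule countable_UN) (auto intro: countable_finite finite_sphere)
qed

section \<open>The averaging operator of simple random walk\<close>

definition avg :: "('v \<Rightarrow> real) \<Rightarrow> 'v \<Rightarrow> real" where
  "avg f x = (\<Sum>y | adj x y. f y) / deg"

lemma avg_const [simp]: "avg (\<lambda>_. c) = (\<lambda>_. c)"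
  using deg_pos by (auto simp: avg_def card_neighbours fun_eq_iff)

lemma avg_add: "avg (\<lambda>y. f y + g y) = (\<lambda>x. avg f x + avg g x)"
  by (auto simp: avg_def fun_eq_iff sum.distrib add_divide_distrib)

lemma avg_diff: "avg (\<lambda>y. f y - g y) = (\<lambda>x. avg f x - avg g x)"
  by (auto simp: avg_def fun_eq_iff sum_subtractf diff_divide_distrib)

lemma avg_cmult: "avg (\<lambda>y. c * f y) = (\<lambda>x. c * avg f x)"
  by (auto simp: avg_def fun_eq_iff sum_distrib_left)

lemma avg_mono: "(\<And>y. adj x y \<Longrightarrow> f y \<le> g y) \<Longrightarrow> avg f x \<le> avg g x"
  by (auto simp: avg_def intro!: divide_right_mono sum_mono)

lemma avg_ge_neighbour:
  assumes "\<And>y. f y \<ge> 0" "adj x y"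
  shows "f y / deg \<le> avg f x"
  using assms member_le_sum[of y "{y. adj x y}" f]
  by (auto simp: avg_def intro!: divide_right_mono)

lemma avg_automorphism:
  assumes "graph_automorphism adj \<phi>"
  shows "avg (\<lambda>y. f (\<phi> y)) x = avg f (\<phi> x)"
  using sum.reindex_bij_betw[OF automorphism_neighbours[OF assms, of x], of f]
  by (simp add: avg_def)

abbreviation avgs :: "nat \<Rightarrow> ('v \<Rightarrow> real) \<Rightarrow> 'v \<Rightarrow> real" where
  "avgs k \<equiv> avg ^^ k"

lemma avgs_const [simp]: "avgs k (\<lambda>_. c) = (\<lambda>_. c)"
  by (induction k) auto

lemma avgs_add: "avgs k (\<lambda>y. f y + g y) = (\<lambda>x. avgs k f x + avgs k g x)"
  by (induction k) (auto simp: avg_add)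

lemma avgs_cmult: "avgs k (\<lambda>y. c * f y) = (\<lambda>x. c * avgs k f x)"
  by (induction k) (auto simp: avg_cmult)

lemma avgs_sum: "avgs k (\<lambda>y. \<Sum>i\<in>I. f i y) = (\<lambda>x. \<Sum>i\<in>I. avgs k (f i) x)"
  by (induction I rule: infinite_finite_induct) (auto simp: avgs_add)

lemma avgs_mono:
  assumes "\<And>y. (adj ^^ k) x y \<Longrightarrow> f y \<le> g y"
  shows "avgs k f x \<le> avgs k g x"
  using assms
proof (induction k arbitrary: x)
  case (Suc k)
  show ?case
    unfolding funpow.simps o_def
    by (intro avg_mono Suc.IH Suc.prems) (rule relpowp_Suc_I2)
qed auto

lemma avgs_cong:
  assumes "\<And>y. (adj ^^ k) x y \<Longrightarrow> f y = g y"
  shows "avgs k f x = avgs k g x"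
  using assms by (intro antisym avgs_mono) auto

lemma avgs_nonneg: "(\<And>y. f y \<ge> 0) \<Longrightarrow> avgs k f x \<ge> 0"
  using avgs_mono[of k x "\<lambda>_. 0" f] by auto

lemma avgs_automorphism:
  assumes "graph_automorphism adj \<phi>"
  shows "avgs k (\<lambda>y. f (\<phi> y)) x = avgs k f (\<phi> x)"
proof (induction k arbitrary: x)
  case (Suc k)
  have "avgs k (\<lambda>y. f (\<phi> y)) = (\<lambda>x. avgs k f (\<phi> x))"
    using Suc by auto
  then show ?case using avg_automorphism[OF assms] by simp
qed simp

subsection \<open>Decay of the heat kernel\<close>

text \<open>The probability that simple random walk from \<open>x\<close> is at \<open>y\<close>
  after \<open>k\<close> steps.\<close>

definition heat :: "nat \<Rightarrow> 'v \<Rightarrow> 'v \<Rightarrow> real" where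
  "heat k x y = avgs k (\<lambda>z. of_bool (z = y)) x"

lemma heat_nonneg: "heat k x y \<ge> 0"
  unfolding heat_def by (intro avgs_nonneg) auto

text \<open>Where it matters, \<open>f\<close> is a finite combination of point indicators. Any
  finite superset \<open>S\<close> is allowed, so that walks from two different vertices can share
  one index set.\<close>

lemma avgs_eq_sum:
  assumes "finite S" "{y. (adj ^^ k) x y} \<subseteq> S"
  shows "avgs k f x = (\<Sum>y\<in>S. heat k x y * f y)"
proof -
  have "avgs k f x = avgs k (\<lambda>z. \<Sum>y\<in>S. f y * of_bool (z = y)) x"
    using assms by (intro avgs_cong) (auto simp: of_bool_def sum.delta if_distrib cong: if_cong)
  also have "\<dots> = (\<Sum>y\<in>S. f y * heat k x y)"
    by (simp add: avgs_sum avgs_cmult heat_def)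
  finally show ?thesis by (simp add: mult.commute)
qed

text \<open>Chapman-Kolmogorov equation.\<close>

lemma heat_add:
  assumes "finite S" "{z. (adj ^^ j) x z} \<subseteq> S"
  shows "heat (j + k) x y = (\<Sum>z\<in>S. heat j x z * heat k z y)"
  using avgs_eq_sum[OF assms, of "\<lambda>z. heat k z y"] by (simp add: heat_def funpow_add)

text \<open>All degrees agree, so the one-step kernel is symmetric. The last step of the walk from
  \<open>x\<close> becomes the first step of the walk from \<open>y\<close>.\<close>

lemma heat_sym: "heat k x y = heat k y x"
proof (induction k arbitrary: x y)
  case (Suc k)
  have 1: "heat 1 z y = of_bool (adj z y) / deg" for z y
    by (auto simp: heat_def avg_def of_bool_def sum.delta if_distrib cong: if_cong)
  define S where "S = {z. (adj ^^ k) x z} \<union> {z. adj y z}"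
  have S: "finite S" "{z. (adj ^^ k) x z} \<subseteq> S" "{z. adj y z} \<subseteq> S"
    by (auto simp: S_def finite_sphere)
  have "heat (Suc k) x y = (\<Sum>z\<in>S. heat k x z * heat 1 z y)"
    using heat_add[OF S(1,2), of 1 y] by simp
  also have "\<dots> = (\<Sum>z\<in>S. heat 1 y z * heat k z x)"
  proof (rule sum.cong[OF refl])
    fix z
    have "heat 1 z y = heat 1 y z"
      unfolding 1 by (subst adj_sym) (rule refl)
    then show "heat k x z * heat 1 z y = heat 1 y z * heat k z x"
      using Suc[of x z] by (simp only: mult.commute)
  qed
  also have "\<dots> = heat (Suc k) y x"
    using heat_add[of S 1 y k x] S by (auto simp: eq_OO)
  finally show ?case .
qed (auto simp: heat_def)

lemma heat_automorphism:
  assumes "graph_automorphism adj \<phi>"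
  shows "heat k (\<phi> x) (\<phi> y) = heat k x y"
proof -
  have "inj \<phi>" using assms by (auto simp: graph_automorphism_def bij_def)
  then have "(\<lambda>z. of_bool (\<phi> z = \<phi> y)) = (\<lambda>z. of_bool (z = y) :: real)"
    by (auto simp: fun_eq_iff dest: injD)
  then show ?thesis
    using avgs_automorphism[OF assms, of k "\<lambda>z. of_bool (z = \<phi> y)" x] by (simp add: heat_def)
qed

lemma heat_diagonal: "heat k x x = heat k y y"
  by (metis obtain_automorphism heat_automorphism)

lemma sum_heat_le_1:
  assumes "finite S"
  shows "(\<Sum>y\<in>S. heat k x y) \<le> 1"
proof -
  have "(\<Sum>y\<in>S. heat k x y) = avgs k (\<lambda>z. \<Sum>y\<in>S. of_bool (z = y)) x"
    by (simp add: avgs_sum heat_def)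
  also have "\<dots> \<le> avgs k (\<lambda>_. 1) x"
    using assms by (intro avgs_mono) (auto simp: of_bool_def sum.delta)
  finally show ?thesis by simp
qed

lemma sum_heat_square:
  assumes "finite S" "{y. (adj ^^ k) x y} \<subseteq> S"
  shows "(\<Sum>y\<in>S. (heat k x y)\<^sup>2) = heat (2 * k) x x"
  using heat_add[OF assms, of k x] heat_sym[of k _ x] by (simp add: power2_eq_square mult_2)

text \<open>Splitting the walk at its midpoint, 2ab \<le> a^2 + b^2 gives the mean of the return
  probabilities at \<open>x\<close> and \<open>y\<close>, both equal to the one at \<open>z\<close>
  by transitivity.\<close>

lemma heat_even_le_diagonal: "heat (2 * k) x y \<le> heat (2 * k) z z"
proof -
  define S where "S = {w. (adj ^^ k) x w} \<union> {w. (adj ^^ k) y w}"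
  have S: "finite S" "{w. (adj ^^ k) x w} \<subseteq> S" "{w. (adj ^^ k) y w} \<subseteq> S"
    by (auto simp: S_def finite_sphere)
  have "heat (2 * k) x y = (\<Sum>w\<in>S. heat k x w * heat k y w)"
    using heat_add[OF S(1,2), of k y] heat_sym[of k _ y] by (simp add: mult_2)
  also have "\<dots> \<le> (\<Sum>w\<in>S. ((heat k x w)\<^sup>2 + (heat k y w)\<^sup>2) / 2)"
    using sum_squares_bound[of "heat k x _" "heat k y _"]
    by (intro sum_mono) (auto simp: field_simps)
  also have "\<dots> = heat (2 * k) z z"
    by (simp add: sum_divide_distrib[symmetric] sum.distrib sum_heat_square S
        heat_diagonal[of _ x z] heat_diagonal[of _ y z])
  finally show ?thesis .
qed

lemma heat_even_Suc: "heat (2 * Suc k) x y = avg (avg (\<lambda>z. heat (2 * k) z y)) x"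
  by (simp add: heat_def)

text \<open>Every vertex lies in this set or next to it, so local finiteness would make the graph
  finite. Parity matters because on a bipartite graph the even-step kernel vanishes off this
  set.\<close>

lemma infinite_even_vertices: "infinite {y. \<exists>k. (adj ^^ (2 * k)) x y}"
proof
  let ?E = "{y. \<exists>k. (adj ^^ (2 * k)) x y}"
  assume fin: "finite ?E"
  have "y \<in> ?E \<union> (\<Union>z\<in>?E. {y. adj z y})" for y
  proof -
    obtain n where n: "(adj ^^ n) x y"
      by (rule obtain_walk)
    show ?thesis
    proof (cases "even n")
      case True
      then show ?thesis using n by (auto elim!: evenE)
    next
      case False
      then obtain k where "n = Suc (2 * k)" by (auto elim!: oddE)
      then show ?thesis using n by auto
    qed
  qed
  then have "UNIV = ?E \<union> (\<Union>z\<in>?E. {y. adj z y})" by blast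
  moreover have "finite (?E \<union> (\<Union>z\<in>?E. {y. adj z y}))"
    using fin by simp
  ultimately show False using infinite_vertices by simp
qed

text \<open>The even return probabilities decrease to a limit. The maximum principle propagates
  this limit to all vertices at even distance; these are infinitely many, and probabilities
  sum to at most one, so the limit vanishes.\<close>

lemma heat_even_tendsto_0: "(\<lambda>k. heat (2 * k) x x) \<longlonglongrightarrow> 0"
proof -
  let ?\<alpha> = "\<lambda>k. heat (2 * k) x x"
  have dec: "decseq ?\<alpha>"
  proof (rule decseq_SucI)
    fix k
    have "heat (2 * Suc k) x x \<le> avg (avg (\<lambda>_. ?\<alpha> k)) x"
      unfolding heat_even_Suc by (intro avg_mono heat_even_le_diagonal)
    then show "?\<alpha> (Suc k) \<le> ?\<alpha> k" by simp
  qed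
  obtain L where L: "?\<alpha> \<longlonglongrightarrow> L" "\<And>k. L \<le> ?\<alpha> k"
    using decseq_convergent[OF dec, of 0] heat_nonneg by auto
  have conv: "(\<lambda>k. heat (2 * k) y x) \<longlonglongrightarrow> L" if "(adj ^^ (2 * n)) x y" for n y
    using that
  proof (induction n arbitrary: y)
    case 0
    then show ?case using L by simp
  next
    case (Suc n)
    obtain z w where zw: "(adj ^^ (2 * n)) x z" "adj z w" "adj w y"
      using Suc.prems by auto
    have lim: "(\<lambda>k. heat (2 * Suc k) z x) \<longlonglongrightarrow> L"
      using Suc.IH[OF zw(1)] by (rule LIMSEQ_Suc)
    \<comment> \<open>The walk from \<open>z\<close> over \<open>w\<close> to \<open>y\<close> has
      probability 1 / deg^2, so the nonnegative deficit at \<open>y\<close> contributes at least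
      this share to the twofold average at \<open>z\<close>.\<close>
    have upper: "(?\<alpha> k - heat (2 * k) y x) / deg / deg \<le> ?\<alpha> k - heat (2 * Suc k) z x" for k
    proof -
      let ?f = "\<lambda>v. ?\<alpha> k - heat (2 * k) v x"
      have nn: "?f v \<ge> 0" for v using heat_even_le_diagonal[of k v x x] by simp
      have nn': "avg ?f v \<ge> 0" for v using avgs_nonneg[of ?f 1 v] nn by simp
      have "?f y / deg / deg \<le> avg ?f w / deg"
        using avg_ge_neighbour[of ?f w y] nn zw by (intro divide_right_mono) auto
      also have "\<dots> \<le> avg (avg ?f) z"
        using avg_ge_neighbour[of "avg ?f" z w] nn' zw by auto
      also have "\<dots> = ?\<alpha> k - heat (2 * Suc k) z x"
        by (simp only: avg_diff avg_const heat_even_Suc)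
      finally show ?thesis .
    qed
    have "(\<lambda>k. ?\<alpha> k - heat (2 * k) y x) \<longlonglongrightarrow> 0"
    proof (rule tendsto_sandwich[OF _ _ tendsto_const])
      show "\<forall>\<^sub>F k in sequentially. 0 \<le> ?\<alpha> k - heat (2 * k) y x"
        using heat_even_le_diagonal by simp
      show "\<forall>\<^sub>F k in sequentially. ?\<alpha> k - heat (2 * k) y x
          \<le> (?\<alpha> k - heat (2 * Suc k) z x) * deg * deg"
        using upper deg_pos by (intro always_eventually) (simp add: field_simps)
      show "(\<lambda>k. (?\<alpha> k - heat (2 * Suc k) z x) * deg * deg) \<longlonglongrightarrow> 0"
        using tendsto_mult_left[OF tendsto_mult_left[OF tendsto_diff[OF L(1) lim]], of deg deg]
        by (simp add: mult.commute mult.left_commute)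
    qed
    from tendsto_diff[OF L(1) this] show ?case by simp
  qed
  have bound: "real N * L \<le> 1" for N
  proof -
    obtain S where S: "finite S" "card S = N" "S \<subseteq> {y. \<exists>k. (adj ^^ (2 * k)) x y}"
      using infinite_arbitrarily_large[OF infinite_even_vertices] by metis
    have "(\<lambda>k. \<Sum>y\<in>S. heat (2 * k) y x) \<longlonglongrightarrow> (\<Sum>y\<in>S. L)"
      using S conv by (intro tendsto_sum) auto
    moreover have "(\<Sum>y\<in>S. heat (2 * k) y x) \<le> 1" for k
      using sum_heat_le_1[OF S(1), of "2 * k" x] heat_sym[of _ x] by simp
    ultimately have "(\<Sum>y\<in>S. L) \<le> 1"
      by (intro LIMSEQ_le_const2) auto
    then show ?thesis using S by simp
  qed
  have "L \<ge> 0"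
    using L(1) heat_nonneg by (intro LIMSEQ_le_const) auto
  moreover have "\<not> L > 0"
    using bound reals_Archimedean3[of L] by (metis not_less)
  ultimately show ?thesis using L by simp
qed

text \<open>Jensen's inequality: the variance of \<open>f\<close> under the \<open>k\<close>-step
  distribution is nonnegative.\<close>

lemma avgs_square_le: "(avgs k f x)\<^sup>2 \<le> avgs k (\<lambda>y. (f y)\<^sup>2) x"
proof -
  define m where "m = avgs k f x"
  have "(\<lambda>y. (f y - m)\<^sup>2) = (\<lambda>y. (f y)\<^sup>2 + (- 2 * m) * f y + m\<^sup>2)"
    by (simp add: fun_eq_iff power2_eq_square algebra_simps)
  then have "avgs k (\<lambda>y. (f y - m)\<^sup>2) x = avgs k (\<lambda>y. (f y)\<^sup>2) x + (- 2 * m) * m + m\<^sup>2"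
    by (simp only: avgs_add avgs_cmult avgs_const m_def)
  moreover have "avgs k (\<lambda>y. (f y - m)\<^sup>2) x \<ge> 0"
    by (intro avgs_nonneg) simp
  ultimately show ?thesis
    by (simp add: m_def power2_eq_square)
qed

text \<open>Iterating the equation \<open>n\<close> times leaves the remainder
  \<open>avgs n h x\<close>, which is nonnegative.\<close>

lemma sum_avgs_le_of_superharmonic:
  assumes nonneg: "\<And>y. h y \<ge> 0" and eq: "\<And>y. h y = avg h y + b y"
  shows "(\<Sum>k<n. avgs k b x) \<le> h x"
proof -
  have "h x = avgs n h x + (\<Sum>k<n. avgs k b x)"
  proof (induction n)
    case (Suc n)
    have "avgs n h = avgs n (\<lambda>y. avg h y + b y)"
      by (rule arg_cong[of _ _ "avgs n"]) (rule ext, rule eq)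
    also have "\<dots> = (\<lambda>x. avgs (Suc n) h x + avgs n b x)"
      by (simp add: avgs_add funpow_swap1)
    finally have "avgs n h x = avgs (Suc n) h x + avgs n b x"
      by (rule fun_cong)
    with Suc show ?case unfolding sum.lessThan_Suc by linarith
  qed simp
  moreover have "avgs n h x \<ge> 0" by (intro avgs_nonneg nonneg)
  ultimately show ?thesis by linarith
qed

subsection \<open>Parallel toppling\<close>

text \<open>With this scaling the stabilization inequality reads
  \<open>surplus s x + avg f x \<le> f x\<close>.\<close>

definition surplus :: "('v \<Rightarrow> real) \<Rightarrow> 'v \<Rightarrow> real" where
  "surplus s x = (s x - 1) / deg"

text \<open>The total mass sent from \<open>x\<close> to each neighbour in \<open>n\<close> rounds.
  As the sequence increases from 0, the recursion agrees with adding the positive part of the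
  current excess per neighbour.\<close>

primrec topple :: "nat \<Rightarrow> ('v \<Rightarrow> real) \<Rightarrow> 'v \<Rightarrow> real" where
  "topple 0 s = (\<lambda>_. 0)"
| "topple (Suc n) s = (\<lambda>x. max 0 (surplus s x + avg (topple n s) x))"

text \<open>Integer bounds keep the existential quantifier countable, as measurability
  requires.\<close>

definition topple_bounded :: "('v \<Rightarrow> real) \<Rightarrow> bool" where
  "topple_bounded s \<longleftrightarrow> (\<forall>x. \<exists>K::nat. \<forall>n. topple n s x \<le> real K)"

text \<open>The limit is guaranteed to exist only under \<open>topple_bounded\<close>.\<close>

definition odometer :: "('v \<Rightarrow> real) \<Rightarrow> 'v \<Rightarrow> real" where
  "odometer s x = lim (\<lambda>n. topple n s x)"

text \<open>A stabilizing \<open>f\<close> is a supersolution of the monotone recursion, so it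
  dominates every iterate started from 0.\<close>

lemma topple_le_odometer_of_stabilizing:
  assumes "f \<in> stabilizing_odometers adj s"
  shows "topple n s x \<le> f x"
proof (induction n arbitrary: x)
  case 0
  then show ?case using assms by (simp add: stabilizing_odometers_def)
next
  case (Suc n)
  have f: "f x \<ge> 0" "s x + laplacian adj f x \<le> 1"
    using assms by (auto simp: stabilizing_odometers_def)
  have "laplacian adj f x = deg * (avg f x - f x)"
    using deg_pos by (simp add: laplacian_def avg_def sum_subtractf card_neighbours field_simps)
  then have "surplus s x + avg f x \<le> f x"
    using f(2) deg_pos by (simp add: surplus_def field_simps)
  moreover have "avg (topple n s) x \<le> avg f x"
    by (intro avg_mono Suc.IH)
  ultimately show ?case using f(1) by simp
qed

lemma topple_bounded_if_stabilizes:
  assumes "stabilizes adj s"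
  shows "topple_bounded s"
proof -
  obtain f where f: "f \<in> stabilizing_odometers adj s"
    using assms by (auto simp: stabilizes_def)
  show ?thesis
    unfolding topple_bounded_def
  proof
    fix x
    obtain K where "f x \<le> real K" using real_arch_simple by blast
    then show "\<exists>K::nat. \<forall>n. topple n s x \<le> real K"
      using topple_le_odometer_of_stabilizing[OF f, of _ x] order_trans by blast
  qed
qed

lemma topple_nonneg: "topple n s x \<ge> 0"
  by (cases n) auto

lemma topple_le_Suc: "topple n s x \<le> topple (Suc n) s x"
proof (induction n arbitrary: x)
  case (Suc n)
  have "avg (topple n s) x \<le> avg (topple (Suc n) s) x"
    by (intro avg_mono Suc)
  then show ?case unfolding topple.simps(2)[of "Suc n"] topple.simps(2)[of n] by simp
qed simp

lemma topple_mono: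
  assumes "\<And>x. s x \<le> s' x"
  shows "topple n s x \<le> topple n s' x"
proof (induction n arbitrary: x)
  case (Suc n)
  have "avg (topple n s) x \<le> avg (topple n s') x"
    by (intro avg_mono Suc)
  moreover have "surplus s x \<le> surplus s' x"
    using assms by (simp add: surplus_def divide_right_mono)
  ultimately show ?case by simp
qed simp

lemma topple_automorphism:
  assumes "graph_automorphism adj \<phi>"
  shows "topple n (\<lambda>y. s (\<phi> y)) x = topple n s (\<phi> x)"
proof (induction n arbitrary: x)
  case (Suc n)
  then have "topple n (\<lambda>y. s (\<phi> y)) = (\<lambda>x. topple n s (\<phi> x))" by auto
  then show ?case
    using avg_automorphism[OF assms] by (simp add: surplus_def)
qed simp

lemma topple_bounded_automorphism:
  assumes "graph_automorphism adj \<phi>"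
  shows "topple_bounded (\<lambda>y. s (\<phi> y)) \<longleftrightarrow> topple_bounded s"
proof -
  have "surj \<phi>" using assms by (auto simp: graph_automorphism_def bij_def)
  then show ?thesis
    unfolding topple_bounded_def topple_automorphism[OF assms] by (metis surjD)
qed

lemma topple_bounded_mono:
  assumes "topple_bounded s'" "\<And>x. s x \<le> s' x"
  shows "topple_bounded s"
  unfolding topple_bounded_def
proof
  fix x
  obtain K where K: "\<And>n. topple n s' x \<le> real K"
    using assms(1) by (auto simp: topple_bounded_def)
  have "topple n s x \<le> real K" for n
    by (rule order_trans[OF topple_mono[OF assms(2)] K])
  then show "\<exists>K::nat. \<forall>n. topple n s x \<le> real K" by blast
qed

lemma topple_tendsto_odometer:
  assumes "topple_bounded s"
  shows "(\<lambda>n. topple n s x) \<longlonglongrightarrow> odometer s x"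
proof -
  obtain K where K: "\<And>n. topple n s x \<le> real K"
    using assms by (auto simp: topple_bounded_def)
  have inc: "incseq (\<lambda>n. topple n s x)"
    by (rule incseq_SucI) (rule topple_le_Suc)
  obtain L where "(\<lambda>n. topple n s x) \<longlonglongrightarrow> L"
    by (rule incseq_convergent[OF inc]) (use K in auto)
  then have "convergent (\<lambda>n. topple n s x)" by (rule convergentI)
  then show ?thesis
    by (simp add: odometer_def convergent_LIMSEQ_iff)
qed

lemma avg_topple_tendsto:
  assumes "topple_bounded s"
  shows "(\<lambda>n. avg (topple n s) x) \<longlonglongrightarrow> avg (odometer s) x"
  unfolding avg_def using topple_tendsto_odometer[OF assms] deg_pos
  by (intro tendsto_intros) auto

lemma odometer_mono:
  assumes "topple_bounded s'" "\<And>x. s x \<le> s' x"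
  shows "odometer s x \<le> odometer s' x"
proof (rule LIMSEQ_le)
  show "(\<lambda>n. topple n s x) \<longlonglongrightarrow> odometer s x"
    by (intro topple_tendsto_odometer topple_bounded_mono[OF assms])
  show "(\<lambda>n. topple n s' x) \<longlonglongrightarrow> odometer s' x"
    by (intro topple_tendsto_odometer assms)
qed (use topple_mono[OF assms(2)] in auto)

lemma odometer_nonneg:
  assumes "topple_bounded s"
  shows "odometer s x \<ge> 0"
  by (rule LIMSEQ_le_const[OF topple_tendsto_odometer[OF assms]]) (auto simp: topple_nonneg)

text \<open>Taking positive parts does not enlarge increments, so each one is at most the average of
  the preceding ones; the first is the positive part of the surplus.\<close>

lemma topple_increment_le:
  "topple (Suc n) s x - topple n s x \<le> avgs n (\<lambda>y. \<bar>surplus s y\<bar>) x"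
proof (induction n arbitrary: x)
  case (Suc n)
  have "avg (topple n s) x \<le> avg (topple (Suc n) s) x"
    by (intro avg_mono topple_le_Suc)
  then have "topple (Suc (Suc n)) s x - topple (Suc n) s x
      \<le> avg (topple (Suc n) s) x - avg (topple n s) x"
    unfolding topple.simps by linarith
  also have "\<dots> = avg (\<lambda>y. topple (Suc n) s y - topple n s y) x"
    by (simp add: avg_diff)
  also have "\<dots> \<le> avg (avgs n (\<lambda>y. \<bar>surplus s y\<bar>)) x"
    by (intro avg_mono Suc)
  finally show ?case by simp
next
  case 0
  have "avg (\<lambda>_. 0) x = 0" by simp
  then show ?case by simp
qed

end

text \<open>For every height \<open>K\<close>, f \<le> min f K + f^2 / K. The L2 bound controls the
  second term, dominated convergence the first.\<close>

lemma (in prob_space) expectation_tendsto_0_if_L2_bounded: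
  fixes f :: "nat \<Rightarrow> 'a \<Rightarrow> real"
  assumes [measurable]: "\<And>n. f n \<in> borel_measurable M"
    and nonneg: "\<And>n x. f n x \<ge> 0"
    and int: "\<And>n. integrable M (\<lambda>x. (f n x)\<^sup>2)"
    and bound: "\<And>n. expectation (\<lambda>x. (f n x)\<^sup>2) \<le> C"
    and lim: "AE x in M. (\<lambda>n. f n x) \<longlonglongrightarrow> 0"
  shows "(\<lambda>n. expectation (f n)) \<longlonglongrightarrow> 0"
proof (rule LIMSEQ_I)
  fix r :: real assume "r > 0"
  have intf: "integrable M (f n)" for n
    by (rule square_integrable_imp_integrable) (use int in auto)
  have "C \<ge> 0" by (rule order_trans[OF _ bound[of 0]]) simp
  \<comment> \<open>The \<open>+ 1\<close> keeps \<open>K\<close> positive when \<open>C\<close> is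
    0 and makes \<open>C / K < r / 2\<close> strict.\<close>
  define K where "K = 2 * (C + 1) / r"
  have K: "K > 0" "C / K < r / 2"
    using \<open>r > 0\<close> \<open>C \<ge> 0\<close> by (auto simp: K_def field_simps add_pos_nonneg)
  have intm: "integrable M (\<lambda>x. min (f n x) K)" for n
    using K nonneg by (intro integrable_const_bound[of _ K]) (auto simp: min_def)
  have "(\<lambda>n. expectation (\<lambda>x. min (f n x) K)) \<longlonglongrightarrow> expectation (\<lambda>x. 0)"
  proof (rule integral_dominated_convergence[where w = "\<lambda>_. K"])
    show "AE x in M. (\<lambda>n. min (f n x) K) \<longlonglongrightarrow> 0"
      using lim
    proof eventually_elim
      case (elim x)
      then show ?case
        using tendsto_min[OF elim tendsto_const[of K]] K by simp
    qed
    show "AE x in M. norm (min (f n x) K) \<le> K" for n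
      using K nonneg by (auto simp: min_def)
  qed auto
  then have "\<forall>\<^sub>F n in sequentially. expectation (\<lambda>x. min (f n x) K) < r / 2"
    using \<open>r > 0\<close> by (intro order_tendstoD(2)) auto
  then obtain N where N: "\<And>n. n \<ge> N \<Longrightarrow> expectation (\<lambda>x. min (f n x) K) < r / 2"
    by (auto simp: eventually_sequentially)
  have "norm (expectation (f n) - 0) < r" if "n \<ge> N" for n
  proof -
    have "f n x \<le> min (f n x) K + (f n x)\<^sup>2 / K" for x
    proof (cases "f n x \<le> K")
      case False
      then have "f n x * K \<le> f n x * f n x"
        using nonneg by (intro mult_left_mono) auto
      then have "f n x \<le> (f n x)\<^sup>2 / K"
        using K by (simp add: field_simps power2_eq_square)
      then show ?thesis using K False by simp
    qed (use K in auto)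
    then have "expectation (f n) \<le> expectation (\<lambda>x. min (f n x) K + (f n x)\<^sup>2 / K)"
      using intf int intm by (intro integral_mono) auto
    also have "\<dots> = expectation (\<lambda>x. min (f n x) K) + expectation (\<lambda>x. (f n x)\<^sup>2) / K"
      using int intm by (subst Bochner_Integration.integral_add) auto
    also have "\<dots> \<le> expectation (\<lambda>x. min (f n x) K) + C / K"
      using bound K by (intro add_left_mono divide_right_mono) auto
    also have "\<dots> < r" using N[OF that] K(2) by linarith
    finally show ?thesis
      using Bochner_Integration.integral_nonneg[of M "f n"] nonneg by simp
  qed
  then show "\<exists>no. \<forall>n\<ge>no. norm (expectation (f n) - 0) < r" by blast
qed

section \<open>I.i.d. sandpiles as a product measure\<close>

locale iid_sandpile = transitive_graph adj + mass: prob_space \<mu>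
  for adj :: "'v \<Rightarrow> 'v \<Rightarrow> bool" and \<mu> :: "real measure" +
  assumes sets_mass [measurable_cong]: "sets \<mu> = sets borel"
    and mass_integrable: "integrable \<mu> (\<lambda>t. t)"
    and mass_square_integrable: "integrable \<mu> (\<lambda>t. t\<^sup>2)"
    and mass_mean: "(\<integral>t. t \<partial>\<mu>) = 1"
    and mass_variance: "(\<integral>t. (t - 1)\<^sup>2 \<partial>\<mu>) > 0"
begin

text \<open>On the coordinate space, relabelling by automorphisms and resampling a site are maps of
  configurations.\<close>

abbreviation config :: "('v \<Rightarrow> real) measure" where
  "config \<equiv> \<Pi>\<^sub>M x\<in>UNIV. \<mu>"

sublocale config: prob_space config
  by (intro prob_space_PiM mass.prob_space_axioms)

lemma space_mass [simp]: "space \<mu> = UNIV"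
  using sets_eq_imp_space_eq[OF sets_mass] by simp

lemma space_config [simp]: "space config = UNIV"
  by (simp add: space_PiM PiE_UNIV_domain)

lemma coordinate_measurable_mass: "(\<lambda>s. s x) \<in> measurable config \<mu>"
  by (rule measurable_component_singleton) simp

lemma coordinate_measurable [measurable]: "(\<lambda>s. s x) \<in> borel_measurable config"
  using coordinate_measurable_mass measurable_cong_sets[OF refl sets_mass] by blast

lemma distr_coordinate: "distr config \<mu> (\<lambda>s. s x) = \<mu>"
  using distr_PiM_component[of UNIV "\<lambda>_. \<mu>" x] mass.prob_space_axioms by simp

lemma
  fixes f :: "real \<Rightarrow> real"
  assumes "f \<in> borel_measurable borel"
  shows integrable_coordinate_iff: "integrable config (\<lambda>s. f (s x)) \<longleftrightarrow> integrable \<mu> f"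
    and integral_coordinate: "(\<integral>s. f (s x) \<partial>config) = (\<integral>t. f t \<partial>\<mu>)"
proof -
  have f: "f \<in> borel_measurable \<mu>"
    using assms measurable_cong_sets[OF sets_mass refl] by blast
  show "integrable config (\<lambda>s. f (s x)) \<longleftrightarrow> integrable \<mu> f"
    using integrable_distr_eq[OF coordinate_measurable_mass[of x] f] by (simp add: distr_coordinate)
  show "(\<integral>s. f (s x) \<partial>config) = (\<integral>t. f t \<partial>\<mu>)"
    using integral_distr[OF coordinate_measurable_mass[of x] f] by (simp add: distr_coordinate)
qed

lemma surplus_measurable [measurable]: "(\<lambda>s. surplus s x) \<in> borel_measurable config"
  by (simp add: surplus_def)

lemma avg_measurable:
  assumes "\<And>y. (\<lambda>s. F s y) \<in> borel_measurable N"
  shows "(\<lambda>s. avg (F s) x) \<in> borel_measurable N"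
  unfolding avg_def using assms by (intro borel_measurable_divide borel_measurable_sum) auto

lemma topple_measurable [measurable]: "(\<lambda>s. topple n s x) \<in> borel_measurable config"
proof (induction n arbitrary: x)
  case (Suc n)
  note avg_measurable[OF Suc, measurable]
  show ?case unfolding topple.simps by measurable
qed simp

lemma odometer_measurable [measurable]: "(\<lambda>s. odometer s x) \<in> borel_measurable config"
  unfolding odometer_def by (intro borel_measurable_lim_metric topple_measurable)

lemma topple_bounded_measurable [measurable]: "Measurable.pred config topple_bounded"
proof -
  have "{s. \<exists>K::nat. \<forall>n. topple n s x \<le> real K} \<in> sets config" for x
  proof -
    have "{s \<in> space config. \<exists>K::nat. \<forall>n. topple n s x \<le> real K} \<in> sets config"
      by measurable
    then show ?thesis by simp
  qed
  then have "(\<Inter>x. {s. \<exists>K::nat. \<forall>n. topple n s x \<le> real K}) \<in> sets config"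
    by (intro sets.countable_INT'' countable_vertices) (simp_all flip: space_config)
  also have "(\<Inter>x. {s. \<exists>K::nat. \<forall>n. topple n s x \<le> real K}) = {s. topple_bounded s}"
    by (auto simp: topple_bounded_def)
  finally show ?thesis by (simp add: pred_def)
qed

lemma integrable_avg:
  assumes "\<And>y. integrable N (\<lambda>s. F s y)"
  shows "integrable N (\<lambda>s. avg (F s) x)"
  unfolding avg_def using assms by (intro integrable_divide integrable_sum) auto

lemma integral_avg:
  assumes "\<And>y. integrable N (\<lambda>s. F s y)"
  shows "(\<integral>s. avg (F s) x \<partial>N) = avg (\<lambda>y. \<integral>s. F s y \<partial>N) x"
  unfolding avg_def using assms by simp

lemma integrable_avgs:
  assumes "\<And>y. integrable N (\<lambda>s. F s y)"
  shows "integrable N (\<lambda>s. avgs k (F s) x)"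
proof (induction k arbitrary: x)
  case (Suc k)
  then show ?case using integrable_avg[of N "\<lambda>s. avgs k (F s)"] by simp
qed (use assms in simp)

lemma integral_avgs:
  assumes "\<And>y. integrable N (\<lambda>s. F s y)"
  shows "(\<integral>s. avgs k (F s) x \<partial>N) = avgs k (\<lambda>y. \<integral>s. F s y \<partial>N) x"
proof (induction k arbitrary: x)
  case (Suc k)
  then have "(\<lambda>x. \<integral>s. avgs k (F s) x \<partial>N) = avgs k (\<lambda>y. \<integral>s. F s y \<partial>N)"
    by (rule ext)
  then show ?case
    using integral_avg[of N "\<lambda>s. avgs k (F s)" x] integrable_avgs[OF assms, of k] by simp
qed simp

subsection \<open>Averages of the surplus\<close>

lemma surplus_integrable: "integrable config (\<lambda>s. surplus s x)"
proof -
  have "integrable \<mu> (\<lambda>t. (t - 1) / deg)"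
    by (intro integrable_divide Bochner_Integration.integrable_diff mass_integrable
        mass.integrable_const)
  then show ?thesis
    unfolding surplus_def
    by (subst integrable_coordinate_iff[where f = "\<lambda>t. (t - 1) / deg"]) simp
qed

lemma surplus_square_integrable: "integrable config (\<lambda>s. (surplus s x)\<^sup>2)"
proof -
  have "(\<lambda>t. ((t - 1) / deg)\<^sup>2) = (\<lambda>t. (t\<^sup>2 - 2 * t + 1) / (real deg)\<^sup>2)"
    by (simp add: fun_eq_iff power_divide power2_diff)
  moreover have "integrable \<mu> (\<lambda>t. (t\<^sup>2 - 2 * t + 1) / (real deg)\<^sup>2)"
    using mass_integrable mass_square_integrable by simp
  ultimately show ?thesis
    using integrable_coordinate_iff[of "\<lambda>t. ((t - 1) / deg)\<^sup>2" x] by (simp add: surplus_def)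
qed

lemma expectation_surplus: "config.expectation (\<lambda>s. surplus s x) = 0"
proof -
  have "config.expectation (\<lambda>s. surplus s x) = (\<integral>t. (t - 1) / deg \<partial>\<mu>)"
    using integral_coordinate[of "\<lambda>t. (t - 1) / deg" x] by (simp add: surplus_def)
  also have "\<dots> = ((\<integral>t. t \<partial>\<mu>) - 1) / deg"
    using mass_integrable mass.prob_space by simp
  finally show ?thesis by (simp add: mass_mean)
qed

text \<open>The second moment is the variance because the surplus has mean 0.\<close>

definition surplus_variance :: real where
  "surplus_variance = (\<integral>t. ((t - 1) / deg)\<^sup>2 \<partial>\<mu>)"

lemma expectation_surplus_square: "config.expectation (\<lambda>s. (surplus s x)\<^sup>2) = surplus_variance"
  using integral_coordinate[of "\<lambda>t. ((t - 1) / deg)\<^sup>2" x]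
  by (simp add: surplus_def surplus_variance_def)

lemma indep_surplus: "config.indep_vars (\<lambda>_. borel) (\<lambda>x s. surplus s x) UNIV"
proof -
  have "config.indep_vars (\<lambda>_. \<mu>) (\<lambda>x s. s x) UNIV"
    by (subst config.indep_vars_iff_distr_eq_PiM')
      (simp_all add: coordinate_measurable_mass distr_coordinate restrict_UNIV distr_id2)
  moreover have "(\<lambda>t. (t - 1) / deg) \<in> borel_measurable \<mu>"
    by (subst measurable_cong_sets[OF sets_mass refl]) simp
  ultimately have "config.indep_vars (\<lambda>_. borel) (\<lambda>x s. (s x - 1) / deg) UNIV"
    by (rule config.indep_vars_compose2[where Y = "\<lambda>_ t. (t - 1) / deg"])
  then show ?thesis by (simp add: surplus_def)
qed

lemma
  assumes "x \<noteq> y"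
  shows surplus_mult_integrable: "integrable config (\<lambda>s. surplus s x * surplus s y)"
    and expectation_surplus_mult: "config.expectation (\<lambda>s. surplus s x * surplus s y) = 0"
proof -
  have ind: "config.indep_vars (\<lambda>_. borel) (\<lambda>x s. surplus s x) {x, y}"
    using indep_surplus by (rule config.indep_vars_subset) simp
  show "integrable config (\<lambda>s. surplus s x * surplus s y)"
    using config.indep_vars_integrable[OF _ ind] surplus_integrable assms by simp
  show "config.expectation (\<lambda>s. surplus s x * surplus s y) = 0"
    using config.indep_vars_lebesgue_integral[OF _ ind] surplus_integrable assms
    by (simp add: expectation_surplus)
qed

text \<open>Expanding the square with heat kernel weights, independence and mean 0 remove the mixed
  terms; the squared weights sum to a return probability.\<close>

lemma
  shows avgs_surplus_square_integrable: "integrable config (\<lambda>s. (avgs k (surplus s) x)\<^sup>2)"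
    and expectation_avgs_surplus_square:
      "config.expectation (\<lambda>s. (avgs k (surplus s) x)\<^sup>2) = surplus_variance * heat (2 * k) x x"
proof -
  define S where "S = {y. (adj ^^ k) x y}"
  have S: "finite S" by (simp add: S_def finite_sphere)
  have eq: "(avgs k (surplus s) x)\<^sup>2
      = (\<Sum>y\<in>S. \<Sum>z\<in>S. (heat k x y * heat k x z) * (surplus s y * surplus s z))" for s
    using avgs_eq_sum[OF S, of k x "surplus s"]
    by (simp add: S_def power2_eq_square sum_product mult_ac)
  have int: "integrable config (\<lambda>s. surplus s y * surplus s z)" for y z
    using surplus_mult_integrable[of y z] surplus_square_integrable[of y]
    by (cases "y = z") (auto simp: power2_eq_square)
  show "integrable config (\<lambda>s. (avgs k (surplus s) x)\<^sup>2)"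
    unfolding eq using int by simp
  have "config.expectation (\<lambda>s. (avgs k (surplus s) x)\<^sup>2)
      = (\<Sum>y\<in>S. \<Sum>z\<in>S. (heat k x y * heat k x z)
          * config.expectation (\<lambda>s. surplus s y * surplus s z))"
    unfolding eq using int by simp
  also have "\<dots> = (\<Sum>y\<in>S. \<Sum>z\<in>S. if y = z then surplus_variance * (heat k x y)\<^sup>2 else 0)"
    using expectation_surplus_mult expectation_surplus_square
    by (intro sum.cong) (auto simp: power2_eq_square)
  also have "\<dots> = surplus_variance * (\<Sum>y\<in>S. (heat k x y)\<^sup>2)"
    using S by (simp add: sum_distrib_left)
  also have "\<dots> = surplus_variance * heat (2 * k) x x"
    using sum_heat_square[OF S] by (simp add: S_def)
  finally show "config.expectation (\<lambda>s. (avgs k (surplus s) x)\<^sup>2)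
    = surplus_variance * heat (2 * k) x x" .
qed

lemma avgs_surplus_integrable: "integrable config (\<lambda>s. avgs k (surplus s) x)"
  by (intro integrable_avgs surplus_integrable)

text \<open>The first absolute moment is at most the root of the second, which decays with the heat
  kernel.\<close>

lemma expectation_abs_avgs_surplus_tendsto_0:
  "(\<lambda>k. config.expectation (\<lambda>s. \<bar>avgs k (surplus s) x\<bar>)) \<longlonglongrightarrow> 0"
proof (rule tendsto_sandwich[OF _ _ tendsto_const])
  show "\<forall>\<^sub>F k in sequentially. 0 \<le> config.expectation (\<lambda>s. \<bar>avgs k (surplus s) x\<bar>)"
    by simp
  have "(config.expectation (\<lambda>s. \<bar>avgs k (surplus s) x\<bar>))\<^sup>2
      \<le> surplus_variance * heat (2 * k) x x" for k
    using config.variance_positive[of "\<lambda>s. \<bar>avgs k (surplus s) x\<bar>"]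
      config.variance_eq[of "\<lambda>s. \<bar>avgs k (surplus s) x\<bar>"]
      avgs_surplus_integrable avgs_surplus_square_integrable
    by (simp add: expectation_avgs_surplus_square)
  then show "\<forall>\<^sub>F k in sequentially. config.expectation (\<lambda>s. \<bar>avgs k (surplus s) x\<bar>)
      \<le> sqrt (surplus_variance * heat (2 * k) x x)"
    by (intro always_eventually allI real_le_rsqrt)
  show "(\<lambda>k. sqrt (surplus_variance * heat (2 * k) x x)) \<longlonglongrightarrow> 0"
    using tendsto_real_sqrt[OF tendsto_mult_left[OF heat_even_tendsto_0]] by simp
qed

subsection \<open>Conservation of mass\<close>

lemma integral_automorphism:
  fixes f :: "('v \<Rightarrow> real) \<Rightarrow> real"
  assumes "graph_automorphism adj \<phi>" "f \<in> borel_measurable config"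
  shows "(\<integral>s. f (\<lambda>x. s (\<phi> x)) \<partial>config) = (\<integral>s. f s \<partial>config)"
proof -
  have "inj \<phi>" using assms(1) by (auto simp: graph_automorphism_def bij_def)
  then have *: "distr config config (\<lambda>s x. s (\<phi> x)) = config"
    using distr_PiM_reindex[of UNIV "\<lambda>_. \<mu>" \<phi> UNIV] mass.prob_space_axioms
    by (simp add: restrict_UNIV)
  have "(\<lambda>s x. s (\<phi> x)) \<in> measurable config config"
    by (rule measurable_PiM_single') (auto intro: coordinate_measurable_mass)
  from integral_distr[OF this assms(2)] show ?thesis by (simp add: *)
qed

text \<open>Such a field commutes with relabelling, so under \<open>config\<close> its expectation
  is the same at every vertex.\<close>

definition equivariant :: "(('v \<Rightarrow> real) \<Rightarrow> 'v \<Rightarrow> real) \<Rightarrow> bool" where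
  "equivariant F \<longleftrightarrow> (\<forall>\<phi> s x. graph_automorphism adj \<phi> \<longrightarrow> F (\<lambda>y. s (\<phi> y)) x = F s (\<phi> x))"

lemma integral_equivariant:
  assumes "equivariant F" "\<And>x. (\<lambda>s. F s x) \<in> borel_measurable config"
  shows "(\<integral>s. F s x \<partial>config) = (\<integral>s. F s y \<partial>config)"
proof -
  obtain \<phi> where \<phi>: "graph_automorphism adj \<phi>" "\<phi> x = y"
    by (rule obtain_automorphism)
  have "(\<integral>s. F s x \<partial>config) = (\<integral>s. F (\<lambda>y. s (\<phi> y)) x \<partial>config)"
    by (rule integral_automorphism[OF \<phi>(1) assms(2), symmetric])
  also have "\<dots> = (\<integral>s. F s y \<partial>config)"
    using assms(1) \<phi> by (simp add: equivariant_def)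
  finally show ?thesis .
qed

text \<open>The expectation is constant in the vertex, and averaging fixes constants. This is the
  source of mass conservation.\<close>

lemma integral_avgs_equivariant:
  assumes "equivariant F" "\<And>x. integrable config (\<lambda>s. F s x)"
  shows "(\<integral>s. avgs k (F s) x \<partial>config) = (\<integral>s. F s x \<partial>config)"
proof -
  have "(\<lambda>y. \<integral>s. F s y \<partial>config) = (\<lambda>_. \<integral>s. F s x \<partial>config)"
    by (rule ext) (rule integral_equivariant[OF assms(1) borel_measurable_integrable[OF assms(2)]])
  then have "avgs k (\<lambda>y. \<integral>s. F s y \<partial>config) x = (\<integral>s. F s x \<partial>config)"
    by (simp only: avgs_const)
  then show ?thesis
    by (simp only: integral_avgs[OF assms(2)])
qed

text \<open>Indicator of the event \<open>A\<close>. It is invariant under automorphisms and does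
  not depend on a vertex, so it preserves equivariance and passes through
  \<open>avg\<close>.\<close>

abbreviation ind :: "('v \<Rightarrow> real) \<Rightarrow> real" where
  "ind s \<equiv> of_bool (topple_bounded s)"

lemma ind_measurable: "ind \<in> borel_measurable config"
proof -
  have "ind = (\<lambda>s. if topple_bounded s then 1 else 0)" by auto
  moreover have "(\<lambda>s. if topple_bounded s then 1 else 0 :: real) \<in> borel_measurable config"
    by measurable
  ultimately show ?thesis by simp
qed

lemma equivariant_ind_mult:
  assumes "equivariant F"
  shows "equivariant (\<lambda>s x. ind s * F s x)"
  using assms topple_bounded_automorphism by (simp add: equivariant_def)

lemma integrable_ind_mult:
  fixes f :: "('v \<Rightarrow> real) \<Rightarrow> real"
  assumes "integrable config f"
  shows "integrable config (\<lambda>s. ind s * f s)"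
proof (rule Bochner_Integration.integrable_bound[OF assms])
  show "(\<lambda>s. ind s * f s) \<in> borel_measurable config"
    by (intro borel_measurable_times ind_measurable borel_measurable_integrable assms)
qed (auto simp: of_bool_def)

lemma equivariant_surplus: "equivariant surplus"
  by (simp add: equivariant_def surplus_def)

lemma equivariant_topple: "equivariant (topple n)"
  by (simp add: equivariant_def topple_automorphism)

text \<open>By equivariance the surplus may be replaced by its \<open>k\<close>-fold average for
  every \<open>k\<close>, and these averages tend to 0 in L1.\<close>

lemma expectation_ind_surplus: "config.expectation (\<lambda>s. ind s * surplus s x) = 0"
proof -
  let ?e = "config.expectation (\<lambda>s. ind s * surplus s x)"
  have le: "\<bar>?e\<bar> \<le> config.expectation (\<lambda>s. \<bar>avgs k (surplus s) x\<bar>)" for k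
  proof -
    have "?e = config.expectation (\<lambda>s. avgs k (\<lambda>y. ind s * surplus s y) x)"
      by (rule integral_avgs_equivariant[symmetric])
        (intro equivariant_ind_mult equivariant_surplus integrable_ind_mult surplus_integrable)+
    also have "\<dots> = config.expectation (\<lambda>s. ind s * avgs k (surplus s) x)"
      by (simp only: avgs_cmult)
    also have "\<bar>\<dots>\<bar> \<le> config.expectation (\<lambda>s. \<bar>ind s * avgs k (surplus s) x\<bar>)"
      by (rule integral_abs_bound)
    also have "\<dots> \<le> config.expectation (\<lambda>s. \<bar>avgs k (surplus s) x\<bar>)"
      by (intro integral_mono integrable_abs integrable_ind_mult avgs_surplus_integrable)
        (auto simp: of_bool_def)
    finally show ?thesis .
  qed
  have "\<bar>?e\<bar> \<le> 0"
    by (rule LIMSEQ_le_const[OF expectation_abs_avgs_surplus_tendsto_0[of x]])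
      (intro exI allI impI le)
  then show ?thesis by simp
qed

lemma topple_integrable: "integrable config (\<lambda>s. topple n s x)"
proof (induction n arbitrary: x)
  case (Suc n)
  have "integrable config (\<lambda>s. surplus s x + avg (topple n s) x)"
    by (intro Bochner_Integration.integrable_add surplus_integrable integrable_avg Suc)
  then show ?case
    unfolding topple.simps by (intro integrable_max) auto
qed simp

text \<open>The increments vanish pointwise on \<open>A\<close>; the bound by averages of the
  absolute surplus and Jensen's inequality keep them bounded in L2.\<close>

lemma expectation_ind_increment_tendsto_0:
  "(\<lambda>n. config.expectation (\<lambda>s. ind s * (topple (Suc n) s x - topple n s x))) \<longlonglongrightarrow> 0"
proof (rule config.expectation_tendsto_0_if_L2_bounded)
  let ?f = "\<lambda>n s. ind s * (topple (Suc n) s x - topple n s x)"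
  let ?g = "\<lambda>n s. avgs n (\<lambda>y. (surplus s y)\<^sup>2) x"
  have nonneg: "topple (Suc n) s x - topple n s x \<ge> 0" for n s
    using topple_le_Suc[of n s x] by simp
  show meas: "?f n \<in> borel_measurable config" for n
    by (intro borel_measurable_times borel_measurable_diff ind_measurable topple_measurable)
  show "?f n s \<ge> 0" for n s
    by (intro mult_nonneg_nonneg nonneg) simp
  have int: "integrable config (?g n)" for n
    by (intro integrable_avgs surplus_square_integrable)
  have le: "(?f n s)\<^sup>2 \<le> ?g n s" for n s
  proof -
    have "(?f n s)\<^sup>2 \<le> (avgs n (\<lambda>y. \<bar>surplus s y\<bar>) x)\<^sup>2"
      using topple_increment_le[of n s x] nonneg[of n s]
      by (intro power_mono) (auto simp: of_bool_def simp del: topple.simps)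
    also have "\<dots> \<le> ?g n s"
      using avgs_square_le[of n "\<lambda>y. \<bar>surplus s y\<bar>" x] by simp
    finally show ?thesis .
  qed
  show int': "integrable config (\<lambda>s. (?f n s)\<^sup>2)" for n
  proof (rule Bochner_Integration.integrable_bound[OF int[of n]])
    show "(\<lambda>s. (?f n s)\<^sup>2) \<in> borel_measurable config"
      by (intro borel_measurable_power meas)
    have "norm ((?f n s)\<^sup>2) \<le> norm (?g n s)" for s
      using le[of s n] by (simp del: topple.simps)
    then show "AE s in config. norm ((?f n s)\<^sup>2) \<le> norm (?g n s)" by (rule AE_I2)
  qed
  show "config.expectation (\<lambda>s. (?f n s)\<^sup>2) \<le> surplus_variance" for n
  proof -
    have "config.expectation (\<lambda>s. (?f n s)\<^sup>2) \<le> config.expectation (?g n)"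
      by (rule integral_mono[OF int' int le])
    also have "\<dots> = surplus_variance"
      using integral_avgs_equivariant[of "\<lambda>s y. (surplus s y)\<^sup>2" n x] equivariant_surplus
      by (simp add: equivariant_def surplus_square_integrable expectation_surplus_square)
    finally show ?thesis .
  qed
  have "(\<lambda>n. ?f n s) \<longlonglongrightarrow> 0" for s
  proof (cases "topple_bounded s")
    case True
    have "(\<lambda>n. topple (Suc n) s x - topple n s x) \<longlonglongrightarrow> odometer s x - odometer s x"
      using topple_tendsto_odometer[OF True, of x] by (intro tendsto_diff LIMSEQ_Suc)
    then show ?thesis using True by (simp del: topple.simps)
  qed simp
  then show "AE s in config. (\<lambda>n. ?f n s) \<longlonglongrightarrow> 0" by (rule AE_I2)
qed

text \<open>The residual \<open>g n\<close> of the recursion is nonnegative, and by conservation its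
  expectation on \<open>A\<close> is that of an increment, hence tends to 0. So its limit
  \<open>h\<close> vanishes almost surely on \<open>A\<close>.\<close>

lemma odometer_eq_AE:
  "AE s in config. topple_bounded s \<longrightarrow> (\<forall>x. odometer s x = avg (odometer s) x + surplus s x)"
proof -
  have "AE s in config. topple_bounded s \<longrightarrow> odometer s x = avg (odometer s) x + surplus s x" for x
  proof -
    define g where "g n s = topple (Suc n) s x - avg (topple n s) x - surplus s x" for n s
    define h where "h s = odometer s x - avg (odometer s) x - surplus s x" for s
    have g_nonneg: "g n s \<ge> 0" for n s
      by (simp add: g_def)
    have g_meas: "g n \<in> borel_measurable config" for n
      unfolding g_def
      by (intro borel_measurable_diff topple_measurable avg_measurable surplus_measurable)
    have h_meas: "h \<in> borel_measurable config"
      unfolding h_def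
      by (intro borel_measurable_diff odometer_measurable avg_measurable surplus_measurable)
    have ind_min_h_meas: "(\<lambda>s. ind s * min (h s) 1) \<in> borel_measurable config"
      by (intro borel_measurable_times ind_measurable borel_measurable_min h_meas
          borel_measurable_const)
    have g_int: "integrable config (g n)" for n
      unfolding g_def
      by (intro Bochner_Integration.integrable_diff topple_integrable integrable_avg
          surplus_integrable)
    have lim: "(\<lambda>n. g n s) \<longlonglongrightarrow> h s" if "topple_bounded s" for s
      unfolding g_def h_def
      by (rule tendsto_diff[OF tendsto_diff[OF LIMSEQ_Suc[OF topple_tendsto_odometer[OF that]]
              avg_topple_tendsto[OF that]] tendsto_const])
    have h_nonneg: "h s \<ge> 0" if "topple_bounded s" for s
      by (rule LIMSEQ_le_const[OF lim[OF that]]) (intro exI allI impI g_nonneg)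
    have g_eq: "config.expectation (\<lambda>s. ind s * g n s)
        = config.expectation (\<lambda>s. ind s * (topple (Suc n) s x - topple n s x))" for n
    proof -
      let ?E = config.expectation
      have T: "integrable config (\<lambda>s. ind s * topple m s y)" for m y
        by (intro integrable_ind_mult topple_integrable)
      have A: "integrable config (\<lambda>s. ind s * avg (topple n s) x)"
        by (intro integrable_ind_mult integrable_avg topple_integrable)
      have S: "integrable config (\<lambda>s. ind s * surplus s x)"
        by (intro integrable_ind_mult surplus_integrable)
      have eq: "?E (\<lambda>s. ind s * avg (topple n s) x) = ?E (\<lambda>s. ind s * topple n s x)"
        using integral_avgs_equivariant[OF equivariant_ind_mult[OF equivariant_topple[of n]] T, of 1 x]
        by (simp add: avg_cmult)
      have "?E (\<lambda>s. ind s * g n s) = ?E (\<lambda>s. ind s * topple (Suc n) s x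
          - ind s * avg (topple n s) x - ind s * surplus s x)"
        by (simp only: g_def right_diff_distrib)
      also have "\<dots> = ?E (\<lambda>s. ind s * topple (Suc n) s x) - ?E (\<lambda>s. ind s * topple n s x)"
        by (simp only: Bochner_Integration.integral_diff[OF Bochner_Integration.integrable_diff[OF T A] S]
            Bochner_Integration.integral_diff[OF T A] eq expectation_ind_surplus)
      also have "\<dots> = ?E (\<lambda>s. ind s * (topple (Suc n) s x - topple n s x))"
        by (simp only: right_diff_distrib Bochner_Integration.integral_diff[OF T T])
      finally show ?thesis .
    qed
    \<comment> \<open>Truncation at 1 supplies a dominating constant without any integrability of
      the odometer, and still detects whether \<open>h\<close> is 0.\<close>
    have "(\<lambda>n. config.expectation (\<lambda>s. ind s * min (g n s) 1))
        \<longlonglongrightarrow> config.expectation (\<lambda>s. ind s * min (h s) 1)"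
    proof (rule integral_dominated_convergence[where w = "\<lambda>_. 1"])
      show "AE s in config. (\<lambda>n. ind s * min (g n s) 1) \<longlonglongrightarrow> ind s * min (h s) 1"
        using lim by (intro AE_I2) (auto simp: of_bool_def intro!: tendsto_min)
      show "AE s in config. norm (ind s * min (g n s) 1) \<le> 1" for n
        using g_nonneg by (intro AE_I2) (auto simp: of_bool_def min_def)
      show "(\<lambda>s. ind s * min (g n s) 1) \<in> borel_measurable config" for n
        by (intro borel_measurable_times ind_measurable borel_measurable_min g_meas
            borel_measurable_const)
      show "(\<lambda>s. ind s * min (h s) 1) \<in> borel_measurable config"
        by (rule ind_min_h_meas)
    qed simp
    moreover have min_le: "config.expectation (\<lambda>s. ind s * min (g n s) 1)
        \<le> config.expectation (\<lambda>s. ind s * g n s)" for n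
    proof (rule integral_mono)
      show "integrable config (\<lambda>s. ind s * min (g n s) 1)"
        using g_int by (intro integrable_ind_mult integrable_min) auto
      show "integrable config (\<lambda>s. ind s * g n s)"
        by (intro integrable_ind_mult g_int)
    qed (auto simp: of_bool_def)
    ultimately have "config.expectation (\<lambda>s. ind s * min (h s) 1) \<le> 0"
      using expectation_ind_increment_tendsto_0[of x] unfolding g_eq[symmetric]
      by (intro LIMSEQ_le[where Y = "\<lambda>n. config.expectation (\<lambda>s. ind s * g n s)"])
        (assumption, assumption, intro exI allI impI min_le)
    moreover have nonneg: "ind s * min (h s) 1 \<ge> 0" for s
      using h_nonneg by (auto simp: of_bool_def)
    ultimately have "config.expectation (\<lambda>s. ind s * min (h s) 1) = 0"
      by (intro antisym Bochner_Integration.integral_nonneg) auto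
    moreover have "integrable config (\<lambda>s. ind s * min (h s) 1)"
    proof (rule config.integrable_const_bound[where B = 1])
      show "AE s in config. norm (ind s * min (h s) 1) \<le> 1"
        using h_nonneg by (intro AE_I2) (auto simp: of_bool_def min_def)
    qed (rule ind_min_h_meas)
    ultimately have "AE s in config. ind s * min (h s) 1 = 0"
      using integral_nonneg_eq_0_iff_AE[of config "\<lambda>s. ind s * min (h s) 1"] nonneg by simp
    then show ?thesis
      by (rule AE_mp) (auto simp: h_def min_def split: if_splits intro!: AE_I2)
  qed
  then have "AE s in config. \<forall>x\<in>UNIV. topple_bounded s \<longrightarrow>
      odometer s x = avg (odometer s) x + surplus s x"
    by (subst AE_ball_countable[OF countable_vertices]) blast
  then show ?thesis by (rule AE_mp) auto
qed

subsection \<open>Lowering the mass on a finite set\<close>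

text \<open>Replacing one coordinate by an independent sample preserves the product law; Fubini then
  fixes the old configuration first.\<close>

lemma AE_resample_site:
  assumes "AE s in config. Q s"
  shows "AE s in config. AE t in \<mu>. Q (s(y := t))"
proof -
  let ?I = "UNIV - {y}"
  let ?\<Pi> = "\<Pi>\<^sub>M x\<in>?I. \<mu>"
  interpret \<Pi>: prob_space ?\<Pi>
    by (intro prob_space_PiM mass.prob_space_axioms)
  interpret P: pair_sigma_finite \<mu> ?\<Pi> ..
  interpret P': pair_sigma_finite ?\<Pi> \<mu> ..
  have ins: "insert y ?I = UNIV" by auto
  have "distr (\<mu> \<Otimes>\<^sub>M ?\<Pi>) config (\<lambda>(t, X). X(y := t)) = config"
    using distr_pair_PiM_eq_PiM[of ?I "\<lambda>_. \<mu>" y] mass.prob_space_axioms by (simp add: ins)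
  moreover have "(\<lambda>(t, X). X(y := t)) \<in> measurable (\<mu> \<Otimes>\<^sub>M ?\<Pi>) config"
    unfolding case_prod_beta'
    by (rule measurable_fun_upd[OF _ measurable_snd measurable_fst]) auto
  ultimately have "AE p in \<mu> \<Otimes>\<^sub>M ?\<Pi>. Q ((snd p)(y := fst p))"
    using AE_distrD[of "\<lambda>(t, X). X(y := t)" "\<mu> \<Otimes>\<^sub>M ?\<Pi>" config Q] assms
    by (simp only: case_prod_beta)
  \<comment> \<open>The factors are swapped so that the resampled value becomes the inner
    variable.\<close>
  then have "AE p in distr (?\<Pi> \<Otimes>\<^sub>M \<mu>) (\<mu> \<Otimes>\<^sub>M ?\<Pi>) (\<lambda>(X, t). (t, X)). Q ((snd p)(y := fst p))"
    by (simp only: P.distr_pair_swap[symmetric])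
  from AE_distrD[OF measurable_pair_swap' this]
  have "AE p in ?\<Pi> \<Otimes>\<^sub>M \<mu>. Q ((fst p)(y := snd p))"
    by (simp only: case_prod_beta fst_conv snd_conv)
  from P'.AE_pair[OF this] have "AE X in ?\<Pi>. AE t in \<mu>. Q (X(y := t))"
    by (simp only: fst_conv snd_conv)
  \<comment> \<open>The statement is pulled back to full configurations; the old value at
    \<open>y\<close> is overwritten anyway.\<close>
  moreover have "distr config ?\<Pi> (\<lambda>s. restrict s ?I) = ?\<Pi>"
    using distr_PiM_reindex[of UNIV "\<lambda>_. \<mu>" "\<lambda>x. x" ?I] mass.prob_space_axioms
    by (simp add: restrict_def)
  moreover have "(\<lambda>s. restrict s ?I) \<in> measurable config ?\<Pi>"
    by (rule measurable_restrict_subset) simp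
  ultimately have "AE s in config. AE t in \<mu>. Q ((restrict s ?I)(y := t))"
    using AE_distrD[of "\<lambda>s. restrict s ?I" config ?\<Pi> "\<lambda>X. AE t in \<mu>. Q (X(y := t))"]
    by (simp only:)
  moreover have "(restrict s ?I)(y := t) = s(y := t)" for s :: "'v \<Rightarrow> real" and t
    by (auto simp: fun_eq_iff)
  ultimately show ?thesis by (simp only:)
qed

text \<open>Sites are resampled one at a time. Values below \<open>c\<close> are not negligible, so
  one of them keeps the induction hypothesis valid.\<close>

lemma AE_lower_on_finite:
  assumes "AE s in config. Q s" and c: "\<not> (AE t in \<mu>. c \<le> t)" and "finite F"
  shows "AE s in config. \<exists>s'. (\<forall>x. s' x \<le> s x) \<and> (\<forall>x\<in>F. s' x < c) \<and> Q s'"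
  using \<open>finite F\<close>
proof (induction F)
  case empty
  show ?case using assms(1) by (rule AE_mp) (auto intro!: AE_I2)
next
  case (insert y F)
  let ?R = "\<lambda>s. \<exists>s'. (\<forall>x. s' x \<le> s x) \<and> (\<forall>x\<in>F. s' x < c) \<and> Q s'"
  show ?case
    using insert.IH AE_resample_site[OF insert.IH, of y]
  proof eventually_elim
    case (elim s)
    show ?case
    proof (cases "s y < c")
      case True
      with elim(1) show ?thesis by (auto intro: le_less_trans)
    next
      case False
      have "\<exists>t<c. ?R (s(y := t))"
      proof (rule ccontr)
        assume *: "\<not> (\<exists>t<c. ?R (s(y := t)))"
        have "AE t in \<mu>. c \<le> t"
          using elim(2)
        proof eventually_elim
          case (elim t)
          then show ?case using * by (meson not_less)
        qed
        with c show False by contradiction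
      qed
      then obtain t s' where t: "t < c" and s': "\<And>x. s' x \<le> (s(y := t)) x" "\<And>x. x \<in> F \<Longrightarrow> s' x < c" "Q s'"
        by blast
      have "s' x \<le> s x" for x
        using s'(1)[of x] t False by (cases "x = y") auto
      moreover have "s' x < c" if "x \<in> insert y F" for x
        using that s'(1)[of y] s'(2)[of x] t by auto
      ultimately show ?thesis using s'(3) by blast
    qed
  qed
qed

text \<open>Otherwise the mass is almost surely at least its mean 1, hence equal to 1, contradicting
  positive variance. The factor \<open>deg\<close> makes the threshold correspond to surplus
  \<open>- a\<close>.\<close>

lemma ex_mass_below_mean: "\<exists>a>0 :: real. \<not> (AE t in \<mu>. 1 - a * deg \<le> t)"
proof (rule ccontr)
  assume *: "\<not> (\<exists>a>0 :: real. \<not> (AE t in \<mu>. 1 - a * deg \<le> t))"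
  have "AE t in \<mu>. 1 - inverse (real (Suc n)) \<le> t" for n
  proof -
    have "inverse (real (Suc n)) / deg > 0" using deg_pos by simp
    with * have "AE t in \<mu>. 1 - inverse (real (Suc n)) / deg * deg \<le> t" by blast
    then show ?thesis using deg_pos by simp
  qed
  then have "AE t in \<mu>. \<forall>n. 1 - inverse (real (Suc n)) \<le> t"
    by (simp only: AE_all_countable) blast
  then have ge: "AE t in \<mu>. 0 \<le> t - 1"
  proof eventually_elim
    case (elim t)
    have "(\<lambda>n. 1 - inverse (real (Suc n))) \<longlonglongrightarrow> 1 - 0"
      by (intro tendsto_diff tendsto_const LIMSEQ_inverse_real_of_nat)
    then have "1 - 0 \<le> t"
      by (rule LIMSEQ_le_const2) (use elim in blast)
    then show ?case by simp
  qed
  have int: "integrable \<mu> (\<lambda>t. t - 1)"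
    by (intro Bochner_Integration.integrable_diff mass_integrable mass.integrable_const)
  have "(\<integral>t. t - 1 \<partial>\<mu>) = 0"
    using mass_integrable mass_mean mass.prob_space
    by (subst Bochner_Integration.integral_diff) auto
  then have "AE t in \<mu>. t - 1 = 0"
    using integral_nonneg_eq_0_iff_AE[OF int ge] by simp
  then have "AE t in \<mu>. (t - 1)\<^sup>2 = 0"
    by (rule AE_mp) (auto intro!: AE_I2)
  then have "(\<integral>t. (t - 1)\<^sup>2 \<partial>\<mu>) = 0"
    by (rule integral_eq_zero_AE)
  then show False using mass_variance by simp
qed

text \<open>The odometer equation holds for both \<open>s\<close> and a lowered \<open>s'\<close>,
  so the difference of the odometers is a nonnegative solution of \<open>h y = avg h y + b y\<close>
  with source \<open>b\<close> the drop in surplus.\<close>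

lemma odometer_ge_AE:
  fixes a :: real
  assumes a: "\<not> (AE t in \<mu>. 1 - a * deg \<le> t)"
  shows "AE s in config. topple_bounded s \<longrightarrow>
    a * n + (\<Sum>k<n. avgs (m + k) (surplus s) x) \<le> odometer s x"
proof -
  \<comment> \<open>Contains every vertex seen by the averages of order below \<open>m + n\<close>
    at \<open>x\<close>.\<close>
  define F where "F = (\<Union>k<m + n. {y. (adj ^^ k) x y})"
  have "finite F" by (simp add: F_def finite_sphere)
  show ?thesis
    using odometer_eq_AE AE_lower_on_finite[OF odometer_eq_AE a \<open>finite F\<close>]
  proof eventually_elim
    case (elim s)
    show ?case
    proof
      assume s: "topple_bounded s"
      obtain s' where s': "\<And>y. s' y \<le> s y" "\<And>y. y \<in> F \<Longrightarrow> s' y < 1 - a * deg"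
        "topple_bounded s' \<Longrightarrow> odometer s' y = avg (odometer s') y + surplus s' y" for y
        using elim(2) by blast
      have bdd: "topple_bounded s'" by (rule topple_bounded_mono[OF s s'(1)])
      define h where "h y = odometer s y - odometer s' y" for y
      define b where "b y = surplus s y - surplus s' y" for y
      have b_nonneg: "b y \<ge> 0" for y
        using s'(1)[of y] by (simp add: b_def surplus_def divide_right_mono)
      have h_nonneg: "h y \<ge> 0" for y
        using odometer_mono[OF s s'(1), of y] by (simp add: h_def)
      have h_eq: "h y = avg h y + b y" for y
      proof -
        have "avg h y = avg (odometer s) y - avg (odometer s') y"
          unfolding h_def avg_diff ..
        moreover have "odometer s y = avg (odometer s) y + surplus s y"
          using elim(1) s by blast
        moreover note s'(3)[OF bdd, of y]
        ultimately show ?thesis unfolding h_def[of y] b_def by linarith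
      qed
      have block: "a + avgs k (surplus s) x \<le> avgs k b x" if "k < m + n" for k
      proof -
        have "a + avgs k (surplus s) x = avgs k (\<lambda>y. a + surplus s y) x"
          by (simp add: avgs_add)
        also have "\<dots> \<le> avgs k b x"
        proof (rule avgs_mono)
          fix y assume "(adj ^^ k) x y"
          then have "s' y \<le> 1 - a * deg"
            using s'(2)[of y] that by (force simp: F_def)
          then have "surplus s' y \<le> - a"
            using deg_pos by (simp add: surplus_def pos_divide_le_eq)
          then show "a + surplus s y \<le> b y" by (simp add: b_def)
        qed
        finally show ?thesis .
      qed
      have "a * n + (\<Sum>k<n. avgs (m + k) (surplus s) x) = (\<Sum>k<n. a + avgs (m + k) (surplus s) x)"
        by (simp add: sum.distrib)
      also have "\<dots> \<le> (\<Sum>k<n. avgs (m + k) b x)"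
        by (intro sum_mono block) simp
      also have "\<dots> = (\<Sum>k\<in>{m..<m + n}. avgs k b x)"
        by (rule sum.reindex_bij_witness[of _ "\<lambda>k. k - m" "\<lambda>k. m + k"]) auto
      also have "\<dots> \<le> (\<Sum>k<m + n. avgs k b x)"
        by (intro sum_mono2 avgs_nonneg b_nonneg) auto
      also have "\<dots> \<le> h x"
        by (rule sum_avgs_le_of_superharmonic[OF h_nonneg h_eq])
      also have "\<dots> \<le> odometer s x"
        using odometer_nonneg[OF bdd, of x] by (simp add: h_def)
      finally show "a * n + (\<Sum>k<n. avgs (m + k) (surplus s) x) \<le> odometer s x" .
    qed
  qed
qed

text \<open>An odometer value of at most \<open>N\<close> forces late averages of the surplus to be
  large, which is unlikely. A countable union over \<open>N\<close> excludes all finite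
  values.\<close>

lemma AE_not_topple_bounded: "AE s in config. \<not> topple_bounded s"
proof -
  obtain a :: real where a: "a > 0" "\<not> (AE t in \<mu>. 1 - a * deg \<le> t)"
    using ex_mass_below_mean by blast
  define x :: 'v where "x = undefined"
  have "AE s in config. topple_bounded s \<longrightarrow> \<not> odometer s x \<le> real N" for N :: nat
  proof -
    define B where "B = {s. topple_bounded s \<and> odometer s x \<le> real N}"
    have "{s \<in> space config. topple_bounded s \<and> odometer s x \<le> real N} \<in> sets config"
      by measurable
    then have B: "B \<in> sets config" by (simp add: B_def)
    \<comment> \<open>The margin 1 makes the sum of absolute averages at least 1 on
      \<open>B\<close>, so it dominates the indicator.\<close>
    obtain n where n: "real N + 1 \<le> a * real n"
      using real_arch_simple[of "(real N + 1) / a"] a(1) by (auto simp: field_simps)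
    let ?E = "\<lambda>k. config.expectation (\<lambda>s. \<bar>avgs k (surplus s) x\<bar>)"
    have le: "config.prob B \<le> (\<Sum>k<n. ?E (m + k))" for m
    proof -
      have int: "integrable config (\<lambda>s. \<bar>avgs k (surplus s) x\<bar>)" for k
        by (intro integrable_abs avgs_surplus_integrable)
      have "config.prob B = config.expectation (indicator B)"
        using B by simp
      also have "\<dots> \<le> config.expectation (\<lambda>s. \<Sum>k<n. \<bar>avgs (m + k) (surplus s) x\<bar>)"
      proof (rule integral_mono_AE)
        show "integrable config (indicator B :: _ \<Rightarrow> real)"
          using B by (simp add: config.emeasure_eq_measure)
        show "integrable config (\<lambda>s. \<Sum>k<n. \<bar>avgs (m + k) (surplus s) x\<bar>)"
          by (intro Bochner_Integration.integrable_sum int)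
        show "AE s in config. indicator B s \<le> (\<Sum>k<n. \<bar>avgs (m + k) (surplus s) x\<bar>)"
          using odometer_ge_AE[OF a(2), of n m x]
        proof eventually_elim
          case (elim s)
          have "- (\<Sum>k<n. avgs (m + k) (surplus s) x) \<le> (\<Sum>k<n. \<bar>avgs (m + k) (surplus s) x\<bar>)"
            unfolding sum_negf[symmetric] by (intro sum_mono) simp
          moreover have "0 \<le> (\<Sum>k<n. \<bar>avgs (m + k) (surplus s) x\<bar>)"
            by (intro sum_nonneg) simp
          ultimately show ?case
            using elim n by (cases "s \<in> B") (auto simp: B_def)
        qed
      qed
      also have "\<dots> = (\<Sum>k<n. ?E (m + k))"
        by (rule Bochner_Integration.integral_sum) (rule int)
      finally show ?thesis .
    qed
    \<comment> \<open>Here \<open>n\<close> is fixed by \<open>N\<close>, while \<open>m\<close> is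
      free to tend to infinity.\<close>
    have "(\<lambda>m. \<Sum>k<n. ?E (m + k)) \<longlonglongrightarrow> (\<Sum>k<n. 0)"
      by (rule tendsto_sum)
        (rule LIMSEQ_ignore_initial_segment[OF expectation_abs_avgs_surplus_tendsto_0])
    then have "config.prob B \<le> (\<Sum>k<n. 0)"
      by (rule LIMSEQ_le_const) (intro exI allI impI le)
    then have "config.prob B = 0"
      by (simp add: antisym)
    then have "AE s in config. s \<notin> B"
      using B by (intro AE_not_in null_setsI) (auto simp: config.emeasure_eq_measure)
    then show ?thesis by (rule AE_mp) (auto simp: B_def intro!: AE_I2)
  qed
  then have "AE s in config. \<forall>N::nat. topple_bounded s \<longrightarrow> \<not> odometer s x \<le> real N"
    by (simp only: AE_all_countable) blast
  then show ?thesis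
  proof eventually_elim
    case (elim s)
    then show ?case using real_arch_simple by blast
  qed
qed

end

section \<open>Transfer to an arbitrary probability space\<close>

theorem theorem1p1:
  fixes adj :: "'v \<Rightarrow> 'v \<Rightarrow> bool"
    and M :: "'a measure"
    and s :: "'v \<Rightarrow> 'a \<Rightarrow> real"
  assumes "undirected_graph adj"
    and "infinite (UNIV :: 'v set)"
    and "graph_connected adj"
    and "locally_finite adj"
    and "vertex_transitive adj"
    and "prob_space M"
    and "\<And>x. s x \<in> borel_measurable M"
    and "prob_space.indep_vars M (\<lambda>_. borel) s UNIV"
    and "\<And>x y. distr M borel (s x) = distr M borel (s y)"
    and "\<And>x. integrable M (s x)"
    and "\<And>x. integrable M (\<lambda>\<omega>. (s x \<omega>)\<^sup>2)"
    and "\<And>x. prob_space.expectation M (s x) = 1"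
    and "\<And>x. prob_space.variance M (s x) > 0"
  shows "AE \<omega> in M. \<not> stabilizes adj (\<lambda>x. s x \<omega>)"
proof -
  interpret prob_space M by fact
  define x\<^sub>0 :: 'v where "x\<^sub>0 = undefined"
  define \<mu> where "\<mu> = distr M borel (s x\<^sub>0)"
  have rv [measurable]: "\<And>x. s x \<in> borel_measurable M" by fact
  have int: "integrable \<mu> f \<longleftrightarrow> integrable M (\<lambda>\<omega>. f (s x\<^sub>0 \<omega>))"
    and integral: "(\<integral>t. f t \<partial>\<mu>) = (\<integral>\<omega>. f (s x\<^sub>0 \<omega>) \<partial>M)"
    if "f \<in> borel_measurable borel" for f :: "real \<Rightarrow> real"
    using that by (simp_all add: \<mu>_def integrable_distr_eq integral_distr)
  interpret iid_sandpile adj \<mu>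
  proof (intro iid_sandpile.intro iid_sandpile_axioms.intro transitive_graph.intro)
    show "prob_space \<mu>" unfolding \<mu>_def by (rule prob_space_distr) (rule rv)
    show "sets \<mu> = sets borel" by (simp add: \<mu>_def)
    show "integrable \<mu> (\<lambda>t. t)" "integrable \<mu> (\<lambda>t. t\<^sup>2)"
      using assms(10,11) by (simp_all add: int)
    show "(\<integral>t. t \<partial>\<mu>) = 1" "(\<integral>t. (t - 1)\<^sup>2 \<partial>\<mu>) > 0"
      using assms(12) assms(13)[of x\<^sub>0] by (simp_all add: integral)
  qed fact+
  \<comment> \<open>Independence makes the joint law a product, and equal marginals identify it with
    \<open>config\<close>.\<close>
  have "distr M (\<Pi>\<^sub>M x\<in>UNIV. borel) (\<lambda>\<omega>. \<lambda>x\<in>UNIV. s x \<omega>) = (\<Pi>\<^sub>M x\<in>UNIV. distr M borel (s x))"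
    using assms(8) by (subst indep_vars_iff_distr_eq_PiM'[symmetric]) auto
  also have "\<dots> = config"
    by (intro PiM_cong) (auto simp: \<mu>_def intro: assms(9))
  finally have "AE t in distr M (\<Pi>\<^sub>M x\<in>UNIV. borel) (\<lambda>\<omega>. \<lambda>x\<in>UNIV. s x \<omega>). \<not> topple_bounded t"
    using AE_not_topple_bounded by (simp only:)
  then have "AE \<omega> in M. \<not> topple_bounded (\<lambda>x\<in>UNIV. s x \<omega>)"
    by (rule AE_distrD[rotated]) (intro measurable_restrict rv)
  then show ?thesis
    by (rule AE_mp) (auto simp: restrict_UNIV intro!: AE_I2 dest: topple_bounded_if_stabilizes)
qed

end
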